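(* Let $\sigma$ be a connection on $B(\mathcal{H})^+$ with representing function $f:[0,\infty)\to[0,\infty)$ and associated measure $\mu$ on $[0,1]$. Then the following statements are equivalent: (1) $f(0)=0$; (2) $\mu(\{0\})=0$; (3) $I\,\sigma\,0=0$; (4) $A\,\sigma\,0=0$ for all $A\ge 0$; (5) for each $A\ge 0$, $0\in\operatorname{Sp}(A)$ implies $0\in\operatorname{Sp}(I\,\sigma\,A)$; (6) for each $A,X\ge 0$, $0\in\operatorname{Sp}(A)$ implies $0\in\operatorname{Sp}(X\,\sigma\,A)$.
   Context: $\mathcal{H}$ is a Hilbert space, $B(\mathcal{H})$ the bounded linear operators on it, $B(\mathcal{H})^+$ the positive (semidefinite) operators; $A\le B$ means $B-A\in B(\mathcal{H})^+$; $A>0$ means $A$ is strictly positive (positive and invertible); $\operatorname{Sp}(X)$ is the spectrum of $X$. A connection is a binary operation $\sigma$ on $B(\mathcal{H})^+$ such that for all positive $A,B,C,D$: (M1) $A\le C$, $B\le D$ imply $A\,\sigma\,B\le C\,\sigma\,D$; (M2) $C(A\,\sigma\,B)C\le (CAC)\,\sigma\,(CBC)$; (M3) if $A_n\downarrow A$ and $B_n\downarrow B$ then $A_n\,\sigma\,B_n\downarrow A\,\sigma\,B$, where $A_n\downarrow A$ means $(A_n)$ is a decreasing sequence converging strongly to $A$. A function $f:[0,\infty)\to[0,\infty)$ is operator monotone if (with the continuous functional calculus, $f$ continuous) $A\le B$ implies $f(A)\le f(B)$ for all positive operators $A,B$ on every Hilbert space. Representing function (Kubo–Ando theorem, taken as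 known): for a connection $\sigma$ there is a unique operator monotone $f:[0,\infty)\to[0,\infty)$ with $f(x)I=I\,\sigma\,(xI)$ for all $x\ge 0$; $\sigma\mapsto f$ is a bijection, and $f(A)=I\,\sigma\,A$ for all $A\ge0$. Associated measure (taken as known): for a connection $\sigma$ there is a unique finite positive Borel measure $\mu$ on $[0,1]$ with $A\,\sigma\,B=\int_{[0,1]}A\,!_t\,B\,d\mu(t)$ for all $A,B\ge 0$; then $f(x)=\int_{[0,1]}(1\,!_t\,x)\,d\mu(t)$ for $x\ge0$. Here $A\,!_t\,B=[(1-t)A^{-1}+tB^{-1}]^{-1}$ for $A,B>0$, extended to $A,B\ge 0$ as the strong limit of $(A+\epsilon I)\,!_t\,(B+\epsilon I)$ as $\epsilon\downarrow 0$ (so $A\,!_0\,B=A$, $A\,!_1\,B=B$). *)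

theory Defs
  imports "HOL-Analysis.Analysis" "HOL-Computational_Algebra.Polynomial"
begin

text \<open>Complex Hilbert spaces. The inner product is linear in the first argument.
  Definiteness is inherited from the norm; \<open>0 \<le> Re (cinner x x)\<close> follows from \<open>norm_eq_sqrt_cinner\<close>,
  since the square root of a negative real is negative in HOL.\<close>

class complex_inner = real_normed_vector +
  fixes scaleC :: "complex \<Rightarrow> 'a \<Rightarrow> 'a"  (infixr "*\<^sub>C" 75)
    and cinner :: "'a \<Rightarrow> 'a \<Rightarrow> complex"
  assumes scaleC_add_right: "c *\<^sub>C (x + y) = c *\<^sub>C x + c *\<^sub>C y"
    and scaleC_add_left: "(c + d) *\<^sub>C x = c *\<^sub>C x + d *\<^sub>C x"
    and scaleC_scaleC: "c *\<^sub>C d *\<^sub>C x = (c * d) *\<^sub>C x"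
    and scaleC_of_real: "complex_of_real r *\<^sub>C x = r *\<^sub>R x"
    and cinner_add_left: "cinner (x + y) z = cinner x z + cinner y z"
    and cinner_scaleC_left: "cinner (c *\<^sub>C x) y = c * cinner x y"
    and cinner_commute: "cinner x y = cnj (cinner y x)"
    and norm_eq_sqrt_cinner: "norm x = sqrt (Re (cinner x x))"

class chilbert_space = complex_inner + banach

instantiation complex :: complex_inner
begin
definition scaleC_complex :: "complex \<Rightarrow> complex \<Rightarrow> complex" where
  "scaleC_complex c x = c * x"
definition cinner_complex :: "complex \<Rightarrow> complex \<Rightarrow> complex" where
  "cinner_complex x y = x * cnj y"
instance
proof
  fix c d x y z :: complex and r :: real
  show "c *\<^sub>C (x + y) = c *\<^sub>C x + c *\<^sub>C y" "(c + d) *\<^sub>C x = c *\<^sub>C x + d *\<^sub>C x"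
    "c *\<^sub>C d *\<^sub>C x = (c * d) *\<^sub>C x" "complex_of_real r *\<^sub>C x = r *\<^sub>R x"
    by (simp_all add: scaleC_complex_def distrib_left distrib_right mult.assoc scaleR_conv_of_real)
  show "cinner (x + y) z = cinner x z + cinner y z" "cinner (c *\<^sub>C x) y = c * cinner x y"
    "cinner x y = cnj (cinner y x)"
    by (simp_all add: scaleC_complex_def cinner_complex_def algebra_simps)
  show "norm x = sqrt (Re (cinner x x))"
    by (simp add: cinner_complex_def cmod_def power2_eq_square)
qed
end

instance complex :: chilbert_space ..

lemma norm_scaleC: "norm (c *\<^sub>C x) = cmod c * norm (x :: 'a :: complex_inner)"
proof -
  have r: "cinner x x = of_real (Re (cinner x x))"
    using cinner_commute[of x x] by (simp add: complex_eq_iff)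
  have "cinner (c *\<^sub>C x) (c *\<^sub>C x) = c * cnj (c * cinner x x)"
    by (metis cinner_scaleC_left cinner_commute)
  also have "\<dots> = (c * cnj c) * of_real (Re (cinner x x))"
    by (subst r) simp
  also have "\<dots> = of_real ((cmod c)\<^sup>2 * Re (cinner x x))"
    by (simp add: complex_norm_square [symmetric])
  finally show ?thesis
    by (simp add: norm_eq_sqrt_cinner[of x] norm_eq_sqrt_cinner[of "c *\<^sub>C x"] real_sqrt_mult)
qed

text \<open>\<open>B(H)\<close> is the set of complex-linear elements of the library type of bounded real-linear maps.\<close>

definition bounded_ops :: "('h::chilbert_space \<Rightarrow>\<^sub>L 'h) set" where
  "bounded_ops = {T. \<forall>c x. blinfun_apply T (c *\<^sub>C x) = c *\<^sub>C blinfun_apply T x}"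

lift_definition scalar_op :: "complex \<Rightarrow> ('h::chilbert_space \<Rightarrow>\<^sub>L 'h)" is "\<lambda>c x. c *\<^sub>C x"
proof (rule bounded_linear_intro)
  fix c :: complex and x y :: 'h and r :: real
  show "c *\<^sub>C (x + y) = c *\<^sub>C x + c *\<^sub>C y" by (rule scaleC_add_right)
  show "c *\<^sub>C r *\<^sub>R x = r *\<^sub>R c *\<^sub>C x"
    by (simp add: scaleC_of_real[symmetric] scaleC_scaleC mult.commute)
  show "norm (c *\<^sub>C x) \<le> norm x * cmod c" by (simp add: norm_scaleC)
qed

definition is_inverse_op ::
  "('h::chilbert_space \<Rightarrow>\<^sub>L 'h) \<Rightarrow> ('h \<Rightarrow>\<^sub>L 'h) \<Rightarrow> bool" where
  "is_inverse_op T S \<longleftrightarrow> S \<in> bounded_ops \<and> T o\<^sub>L S = id_blinfun \<and> S o\<^sub>L T = id_blinfun"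

definition invertible_op :: "('h::chilbert_space \<Rightarrow>\<^sub>L 'h) \<Rightarrow> bool" where
  "invertible_op T \<longleftrightarrow> (\<exists>S. is_inverse_op T S)"

definition inverse_op :: "('h::chilbert_space \<Rightarrow>\<^sub>L 'h) \<Rightarrow> ('h \<Rightarrow>\<^sub>L 'h)" where
  "inverse_op T = (THE S. is_inverse_op T S)"

definition Sp :: "('h::chilbert_space \<Rightarrow>\<^sub>L 'h) \<Rightarrow> complex set" where
  "Sp T = {c. \<not> invertible_op (T - scalar_op c)}"

definition positive_op :: "('h::chilbert_space \<Rightarrow>\<^sub>L 'h) \<Rightarrow> bool" where
  "positive_op T \<longleftrightarrow> T \<in> bounded_ops \<and>
     (\<forall>x. cinner (blinfun_apply T x) x \<in> \<real> \<and> 0 \<le> Re (cinner (blinfun_apply T x) x))"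

definition strictly_positive_op :: "('h::chilbert_space \<Rightarrow>\<^sub>L 'h) \<Rightarrow> bool" where
  "strictly_positive_op T \<longleftrightarrow> positive_op T \<and> invertible_op T"

definition op_le :: "('h::chilbert_space \<Rightarrow>\<^sub>L 'h) \<Rightarrow> ('h \<Rightarrow>\<^sub>L 'h) \<Rightarrow> bool"  (infix "\<preceq>" 50) where
  "A \<preceq> B \<longleftrightarrow> positive_op (B - A)"

definition decreases_to ::
  "(nat \<Rightarrow> ('h::chilbert_space \<Rightarrow>\<^sub>L 'h)) \<Rightarrow> ('h \<Rightarrow>\<^sub>L 'h) \<Rightarrow> bool" where
  "decreases_to X A \<longleftrightarrow> (\<forall>n. X (Suc n) \<preceq> X n) \<and>
     (\<forall>x. (\<lambda>n. blinfun_apply (X n) x) \<longlonglongrightarrow> blinfun_apply A x)"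

text \<open>A binary operation on positive operators is a function on all operators whose values at
  non-positive arguments are irrelevant.\<close>

definition connection ::
  "(('h::chilbert_space \<Rightarrow>\<^sub>L 'h) \<Rightarrow> ('h \<Rightarrow>\<^sub>L 'h) \<Rightarrow> ('h \<Rightarrow>\<^sub>L 'h)) \<Rightarrow> bool" where
  "connection \<sigma> \<longleftrightarrow>
     (\<forall>A B. positive_op A \<longrightarrow> positive_op B \<longrightarrow> positive_op (\<sigma> A B)) \<and>
     (\<forall>A B C D. positive_op A \<longrightarrow> positive_op B \<longrightarrow> positive_op C \<longrightarrow> positive_op D \<longrightarrow>
        A \<preceq> C \<longrightarrow> B \<preceq> D \<longrightarrow> \<sigma> A B \<preceq> \<sigma> C D) \<and>
     (\<forall>A B C. positive_op A \<longrightarrow> positive_op B \<longrightarrow> positive_op C \<longrightarrow>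
        C o\<^sub>L \<sigma> A B o\<^sub>L C \<preceq> \<sigma> (C o\<^sub>L A o\<^sub>L C) (C o\<^sub>L B o\<^sub>L C)) \<and>
     (\<forall>X Y A B. (\<forall>n. positive_op (X n)) \<longrightarrow> (\<forall>n. positive_op (Y n)) \<longrightarrow>
        positive_op A \<longrightarrow> positive_op B \<longrightarrow> decreases_to X A \<longrightarrow> decreases_to Y B \<longrightarrow>
        decreases_to (\<lambda>n. \<sigma> (X n) (Y n)) (\<sigma> A B))"

definition poly_op :: "real poly \<Rightarrow> ('h::chilbert_space \<Rightarrow>\<^sub>L 'h) \<Rightarrow> ('h \<Rightarrow>\<^sub>L 'h)" where
  "poly_op p A = (\<Sum>i\<le>degree p. coeff p i *\<^sub>R (((\<lambda>S. A o\<^sub>L S) ^^ i) id_blinfun))"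

text \<open>Continuous functional calculus for a self-adjoint operator \<open>A\<close> (so that \<open>Sp A\<close> is real) and a
  real function \<open>f\<close> continuous on \<open>Sp A\<close>: the norm limit of \<open>p\<^sub>n(A)\<close> for polynomials
  \<open>p\<^sub>n\<close> converging to \<open>f\<close> uniformly on \<open>Sp A\<close>.\<close>

definition cfc :: "(real \<Rightarrow> real) \<Rightarrow> ('h::chilbert_space \<Rightarrow>\<^sub>L 'h) \<Rightarrow> ('h \<Rightarrow>\<^sub>L 'h)" where
  "cfc f A = (THE S. \<exists>p :: nat \<Rightarrow> real poly.
     uniform_limit {r. complex_of_real r \<in> Sp A} (\<lambda>n. poly (p n)) f sequentially \<and>
     (\<lambda>n. poly_op (p n) A) \<longlonglongrightarrow> S)"

text \<open>HOL cannot quantify over types inside a formula, so the Hilbert space on which \<open>f\<close> is operator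
  monotone is an explicit type argument; operator monotonicity in the full sense means
  \<open>operator_monotone_on TYPE('h) f\<close> for every Hilbert space type \<open>'h\<close>.\<close>

definition operator_monotone_on :: "'h::chilbert_space itself \<Rightarrow> (real \<Rightarrow> real) \<Rightarrow> bool" where
  "operator_monotone_on _ f \<longleftrightarrow> continuous_on {0..} f \<and> (\<forall>x\<ge>0. 0 \<le> f x) \<and>
     (\<forall>A B :: 'h \<Rightarrow>\<^sub>L 'h. positive_op A \<longrightarrow> positive_op B \<longrightarrow> A \<preceq> B \<longrightarrow> cfc f A \<preceq> cfc f B)"

text \<open>Operator monotonicity is required only on the space of \<open>\<sigma>\<close>. For \<open>\<sigma>\<close> with an associated measure
  on a nonzero space, the equation below determines \<open>f\<close> on \<open>[0,\<infinity>)\<close> and makes it operator monotone on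
  every Hilbert space.\<close>

definition representing_function ::
  "(('h::chilbert_space \<Rightarrow>\<^sub>L 'h) \<Rightarrow> ('h \<Rightarrow>\<^sub>L 'h) \<Rightarrow> ('h \<Rightarrow>\<^sub>L 'h)) \<Rightarrow> (real \<Rightarrow> real) \<Rightarrow> bool" where
  "representing_function \<sigma> f \<longleftrightarrow> operator_monotone_on TYPE('h) f \<and>
     (\<forall>x\<ge>0. f x *\<^sub>R id_blinfun = \<sigma> id_blinfun (x *\<^sub>R id_blinfun))"

definition harmonic_mean_pos ::
  "real \<Rightarrow> ('h::chilbert_space \<Rightarrow>\<^sub>L 'h) \<Rightarrow> ('h \<Rightarrow>\<^sub>L 'h) \<Rightarrow> ('h \<Rightarrow>\<^sub>L 'h)" where
  "harmonic_mean_pos t A B = inverse_op ((1 - t) *\<^sub>R inverse_op A + t *\<^sub>R inverse_op B)"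

definition harmonic_mean ::
  "real \<Rightarrow> ('h::chilbert_space \<Rightarrow>\<^sub>L 'h) \<Rightarrow> ('h \<Rightarrow>\<^sub>L 'h) \<Rightarrow> ('h \<Rightarrow>\<^sub>L 'h)" where
  "harmonic_mean t A B =
     (if strictly_positive_op A \<and> strictly_positive_op B then harmonic_mean_pos t A B
      else (THE S. \<forall>x. ((\<lambda>\<epsilon>. blinfun_apply
              (harmonic_mean_pos t (A + \<epsilon> *\<^sub>R id_blinfun) (B + \<epsilon> *\<^sub>R id_blinfun)) x)
            \<longlongrightarrow> blinfun_apply S x) (at_right 0)))"

text \<open>Operator-valued integrals are taken in the weak sense: the library's Bochner integral needs a
  second countable codomain, which the operator norm topology does not provide.\<close>

definition has_op_integral ::
  "'m measure \<Rightarrow> ('m \<Rightarrow> ('h::chilbert_space \<Rightarrow>\<^sub>L 'h)) \<Rightarrow> ('h \<Rightarrow>\<^sub>L 'h) \<Rightarrow> bool" where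
  "has_op_integral M F S \<longleftrightarrow> S \<in> bounded_ops \<and>
     (\<forall>x y. has_bochner_integral M (\<lambda>t. cinner (blinfun_apply (F t) x) y)
              (cinner (blinfun_apply S x) y))"

definition associated_measure ::
  "(('h::chilbert_space \<Rightarrow>\<^sub>L 'h) \<Rightarrow> ('h \<Rightarrow>\<^sub>L 'h) \<Rightarrow> ('h \<Rightarrow>\<^sub>L 'h)) \<Rightarrow> real measure \<Rightarrow> bool" where
  "associated_measure \<sigma> \<mu> \<longleftrightarrow> finite_measure \<mu> \<and> sets \<mu> = sets (restrict_space borel {0..1}) \<and>
     (\<forall>A B. positive_op A \<longrightarrow> positive_op B \<longrightarrow>
        has_op_integral \<mu> (\<lambda>t. harmonic_mean t A B) (\<sigma> A B))"

end

theory Submission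
  imports Defs
begin

text \<open>
  Everything rests on one estimate: if \<open>C, X, A \<ge> 0\<close> satisfy \<open>C X C \<le> a I\<close> and \<open>C A C \<le> b I\<close>,
  then (M2) for \<open>C / sqrt a\<close> and (M1) give \<open>C (X \<sigma> A) C \<le> a f(b/a) I\<close>. With \<open>C = I\<close> and \<open>b = 0\<close> this
  yields (1) \<open>\<Rightarrow>\<close> (4). For (1) \<open>\<Rightarrow>\<close> (6), take \<open>C = \<epsilon> (A + \<epsilon> I)\<^sup>-\<^sup>1\<close>, for which \<open>C A C \<le> \<epsilon> I\<close>, while
  \<open>C\<close> is nearly isometric on approximate null vectors of \<open>A\<close>. If \<open>X \<sigma> A\<close> were invertible, it would be
  bounded below, contradicting \<open>f(\<epsilon>/a) \<rightarrow> f(0) = 0\<close>. This replaces the spectral projections of \<open>A\<close>.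
  Finally \<open>I !\<^sub>t 0\<close> is \<open>I\<close> for \<open>t = 0\<close> and \<open>0\<close> otherwise, so that \<open>f(0) = \<mu>({0})\<close>.
\<close>

section \<open>Inner products and positive operators\<close>

lemma cinner_add_right: "cinner x (y + z) = cinner x y + cinner x (z :: 'a :: complex_inner)"
  by (metis cinner_add_left cinner_commute complex_cnj_add)

lemma cinner_scaleC_right: "cinner x (c *\<^sub>C y) = cnj c * cinner x (y :: 'a :: complex_inner)"
  by (metis cinner_scaleC_left cinner_commute complex_cnj_mult)

lemma cinner_scaleR_left: "cinner (r *\<^sub>R x) y = of_real r * cinner x (y :: 'a :: complex_inner)"
  by (metis scaleC_of_real cinner_scaleC_left)

lemma cinner_scaleR_right: "cinner x (r *\<^sub>R y) = of_real r * cinner x (y :: 'a :: complex_inner)"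
  by (metis scaleC_of_real cinner_scaleC_right complex_cnj_complex_of_real)

lemma cinner_diff_left: "cinner (x - y) z = cinner x z - cinner y (z :: 'a :: complex_inner)"
  using cinner_add_left[of "x - y" y z] by simp

lemma cinner_diff_right: "cinner x (y - z) = cinner x y - cinner x (z :: 'a :: complex_inner)"
  using cinner_add_right[of x "y - z" z] by simp

lemma scaleC_diff_right: "c *\<^sub>C (x - y) = c *\<^sub>C x - c *\<^sub>C (y :: 'a :: complex_inner)"
  using scaleC_add_right[of c "x - y" y] by simp

lemma scaleR_scaleC: "r *\<^sub>R c *\<^sub>C x = c *\<^sub>C r *\<^sub>R (x :: 'a :: complex_inner)"
  by (simp add: scaleC_of_real[symmetric] scaleC_scaleC mult.commute)

lemma cinner_zero_left: "cinner 0 (y :: 'a :: complex_inner) = 0"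
  using cinner_add_left[of 0 0 y] by simp

lemmas cinner_simps =
  cinner_add_left cinner_add_right cinner_diff_left cinner_diff_right
  cinner_scaleR_left cinner_scaleR_right cinner_scaleC_left cinner_scaleC_right cinner_zero_left

text \<open>The square root of HOL keeps the sign of its argument, so nonnegativity of the norm
  forces \<open>Re (cinner x x)\<close> to be nonnegative; conjugate symmetry removes the imaginary
  part.\<close>

lemma cinner_self: "cinner x x = of_real ((norm (x :: 'a :: complex_inner))\<^sup>2)"
proof -
  have "0 \<le> sqrt (Re (cinner x x))"
    by (metis norm_eq_sqrt_cinner norm_ge_zero)
  then have "(norm x)\<^sup>2 = Re (cinner x x)"
    by (simp add: norm_eq_sqrt_cinner)
  then show ?thesis
    using cinner_commute[of x x] by (simp add: complex_eq_iff)
qed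

text \<open>The real form of Cauchy-Schwarz: expand the squared norm of
  \<open>norm y *\<^sub>R x - norm x *\<^sub>R y\<close> and divide by
  \<open>2 * (norm x * norm y)\<close>.\<close>

lemma Re_cinner_le: "Re (cinner x y) \<le> norm x * norm (y :: 'a :: complex_inner)"
proof (cases "x = 0 \<or> y = 0")
  case True
  then show ?thesis
    using cinner_commute[of x y] by (auto simp: cinner_zero_left)
next
  case False
  have sym: "Re (cinner y x) = Re (cinner x y)"
    using cinner_commute[of x y] by simp
  have "0 \<le> Re (cinner (norm y *\<^sub>R x - norm x *\<^sub>R y) (norm y *\<^sub>R x - norm x *\<^sub>R y))"
    by (subst cinner_self) simp
  also have "\<dots> = 2 * (norm x * norm y) * (norm x * norm y - Re (cinner x y))"
    by (simp only: cinner_simps) (simp add: cinner_self sym algebra_simps power2_eq_square)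
  finally have "0 \<le> 2 * (norm x * norm y) * (norm x * norm y - Re (cinner x y))" .
  moreover have "0 < 2 * (norm x * norm y)"
    using False by simp
  ultimately show ?thesis
    by (metis diff_ge_0_iff_ge zero_le_mult_iff not_less)
qed

section \<open>Quadratic forms and the operator order\<close>

abbreviation qform :: "('h::chilbert_space \<Rightarrow>\<^sub>L 'h) \<Rightarrow> 'h \<Rightarrow> real" where
  "qform T x \<equiv> Re (cinner (blinfun_apply T x) x)"

lemma positive_op_nonneg: "positive_op T \<Longrightarrow> 0 \<le> qform T x"
  by (simp add: positive_op_def)

lemma positive_op_bounded: "positive_op T \<Longrightarrow> T \<in> bounded_ops"
  by (simp add: positive_op_def)

text \<open>Polarization: reality of the form at \<open>x + y\<close> relates the imaginary parts,
  and at \<open>x + \<i> *\<^sub>C y\<close> the real parts. The second point uses complex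
  linearity.\<close>

lemma positive_op_selfadjoint:
  assumes "positive_op T"
  shows "cinner (blinfun_apply T x) y = cinner x (blinfun_apply T y)"
proof -
  have im: "Im (cinner (blinfun_apply T z) z) = 0" for z
    using assms by (simp add: positive_op_def complex_is_Real_iff)
  have lin: "blinfun_apply T (c *\<^sub>C z) = c *\<^sub>C blinfun_apply T z" for c z
    using assms by (simp add: positive_op_def bounded_ops_def)
  have "Im (cinner (blinfun_apply T x) y) = - Im (cinner (blinfun_apply T y) x)"
    using im[of "x + y"] im[of x] im[of y] by (simp add: blinfun.add_right cinner_simps)
  moreover have "Re (cinner (blinfun_apply T x) y) = Re (cinner (blinfun_apply T y) x)"
    using im[of "x + \<i> *\<^sub>C y"] im[of x] im[of y]
    by (simp add: blinfun.add_right lin cinner_simps algebra_simps)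
  ultimately show ?thesis
    using cinner_commute[of x "blinfun_apply T y"] by (simp add: complex_eq_iff)
qed

lemma qform_le_norm: "qform T x \<le> norm T * (norm x)\<^sup>2"
proof -
  have "qform T x \<le> norm (blinfun_apply T x) * norm x"
    by (rule Re_cinner_le)
  also have "\<dots> \<le> norm T * norm x * norm x"
    by (intro mult_right_mono norm_blinfun) simp
  finally show ?thesis
    by (simp add: power2_eq_square mult.assoc)
qed

text \<open>Expand \<open>0 \<le> qform T (x - T x / K)\<close>.\<close>
lemma norm_apply_sq_le_qform:
  assumes T: "positive_op T" and K: "K > 0" "norm T \<le> K"
  shows "(norm (blinfun_apply T x))\<^sup>2 \<le> K * qform T x"
proof -
  let ?y = "blinfun_apply T x"
  have "0 \<le> qform T (x - (1/K) *\<^sub>R ?y)"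
    by (rule positive_op_nonneg[OF T])
  also have "\<dots> = qform T x - 2 / K * (norm ?y)\<^sup>2 + qform T ?y / K\<^sup>2"
    using positive_op_selfadjoint[OF T, of ?y x] K
    by (simp add: blinfun.diff_right blinfun.scaleR_right cinner_simps cinner_self
        field_simps power2_eq_square)
  also have "qform T ?y / K\<^sup>2 \<le> K * (norm ?y)\<^sup>2 / K\<^sup>2"
    by (intro divide_right_mono order_trans[OF qform_le_norm] mult_right_mono K) auto
  also have "\<dots> = (norm ?y)\<^sup>2 / K"
    using K by (simp add: power2_eq_square)
  finally show ?thesis
    using K by (simp add: field_simps)
qed

lemma op_le_imp_qform_le: "A \<preceq> B \<Longrightarrow> qform A x \<le> qform B x"
  using positive_op_nonneg[of "B - A" x] by (simp add: op_le_def blinfun.diff_left cinner_simps)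

text \<open>Positivity of both operators makes their difference complex linear with a real form, so
  only the sign of that form remains to be checked.\<close>

lemma op_leI:
  assumes "positive_op A" "positive_op B" "\<And>x. qform A x \<le> qform B x"
  shows "A \<preceq> B"
  using assms
  by (auto simp: op_le_def positive_op_def bounded_ops_def blinfun.diff_left cinner_simps
      scaleC_diff_right complex_is_Real_iff)

lemma positive_op_scaleR:
  assumes "positive_op T" "r \<ge> 0"
  shows "positive_op (r *\<^sub>R T)"
  using assms
  by (auto simp: positive_op_def bounded_ops_def blinfun.scaleR_left cinner_simps
      scaleR_scaleC complex_is_Real_iff)

lemma positive_op_id: "positive_op id_blinfun"
  by (simp add: positive_op_def bounded_ops_def cinner_self)

lemma positive_op_zero: "positive_op 0"
  using positive_op_scaleR[OF positive_op_id, of 0] by simp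

lemma cinner_conjugate:
  assumes "positive_op C"
  shows "cinner (blinfun_apply (C o\<^sub>L T o\<^sub>L C) x) x
    = cinner (blinfun_apply T (blinfun_apply C x)) (blinfun_apply C x)"
  by (simp add: positive_op_selfadjoint[OF assms])

lemma positive_op_conjugate:
  assumes "positive_op C" "positive_op T"
  shows "positive_op (C o\<^sub>L T o\<^sub>L C)"
  using assms cinner_conjugate[OF assms(1), of T]
  by (simp add: positive_op_def bounded_ops_def)

section \<open>Invertibility and the spectral value zero\<close>

lemma zero_in_Sp_iff: "0 \<in> Sp (T :: 'h::chilbert_space \<Rightarrow>\<^sub>L 'h) \<longleftrightarrow> \<not> invertible_op T"
proof -
  have "(scalar_op 0 :: 'h \<Rightarrow>\<^sub>L 'h) = 0"
    by (rule blinfun_eqI, transfer) (metis of_real_0 scaleC_of_real scaleR_zero_left)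
  then show ?thesis
    by (simp add: Sp_def)
qed

text \<open>The Lax--Milgram argument: \<open>x \<mapsto> x - s (T x - y)\<close> is a contraction for a suitable \<open>s\<close>.\<close>
lemma coercive_imp_invertible:
  fixes T :: "'h::chilbert_space \<Rightarrow>\<^sub>L 'h"
  assumes T: "T \<in> bounded_ops" and c: "c > 0" and coerc: "\<And>x. c * (norm x)\<^sup>2 \<le> qform T x"
  shows "invertible_op T"
proof -
  define K where "K = norm T + c"
  \<comment> \<open>This choice minimises \<open>1 - 2 * s * c + s\<^sup>2 * K\<^sup>2\<close>, the
    bound on the squared contraction factor; the minimum is \<open>q\<^sup>2\<close>. The summand
    \<open>c\<close> in \<open>K\<close> ensures \<open>0 < c \<le> K\<close>, so that the radicand
    in \<open>q\<close> lies in [0,1).\<close>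
  define s where "s = c / K\<^sup>2"
  define q where "q = sqrt (1 - c\<^sup>2 / K\<^sup>2)"
  have K: "K > 0" "norm T \<le> K" "c \<le> K"
    using c by (auto simp: K_def add_nonneg_pos)
  have cK: "c\<^sup>2 \<le> K\<^sup>2"
    using c K by (intro power_mono) auto
  have q: "0 \<le> q" "q < 1" "q\<^sup>2 = 1 - c\<^sup>2 / K\<^sup>2"
    using c K cK by (auto simp: q_def)
  have s: "0 < s"
    using c K by (simp add: s_def)
  have contr: "norm (x - s *\<^sub>R blinfun_apply T x) \<le> q * norm x" for x
  proof (rule power2_le_imp_le)
    have sym: "Re (cinner x (blinfun_apply T x)) = qform T x"
      using cinner_commute[of x "blinfun_apply T x"] by simp
    have nT: "(norm (blinfun_apply T x))\<^sup>2 \<le> K\<^sup>2 * (norm x)\<^sup>2"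
      unfolding power_mult_distrib[symmetric]
      by (intro power_mono order_trans[OF norm_blinfun] mult_right_mono K) auto
    have "(norm (x - s *\<^sub>R blinfun_apply T x))\<^sup>2
        = Re (cinner (x - s *\<^sub>R blinfun_apply T x) (x - s *\<^sub>R blinfun_apply T x))"
      by (subst cinner_self) simp
    also have "\<dots> = (norm x)\<^sup>2 - 2 * s * qform T x + s\<^sup>2 * (norm (blinfun_apply T x))\<^sup>2"
      by (simp only: cinner_simps) (simp add: cinner_self sym algebra_simps power2_eq_square)
    also have "\<dots> \<le> (norm x)\<^sup>2 - 2 * s * (c * (norm x)\<^sup>2) + s\<^sup>2 * (K\<^sup>2 * (norm x)\<^sup>2)"
      using s by (intro add_mono diff_mono mult_left_mono coerc nT) auto
    also have "\<dots> = q\<^sup>2 * (norm x)\<^sup>2"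
      using K unfolding q(3) s_def by (simp add: field_simps power2_eq_square)
    finally show "(norm (x - s *\<^sub>R blinfun_apply T x))\<^sup>2 \<le> (q * norm x)\<^sup>2"
      by (simp add: power_mult_distrib)
  qed (use q in simp)
  \<comment> \<open>Cauchy-Schwarz turns coercivity into a lower bound on \<open>T\<close>, which
    yields both injectivity and the bound \<open>1 / c\<close> for the inverse.\<close>
  have lower: "c * norm x \<le> norm (blinfun_apply T x)" for x
  proof (cases "x = 0")
    case False
    have "c * norm x * norm x \<le> norm (blinfun_apply T x) * norm x"
      using coerc[of x] Re_cinner_le[of "blinfun_apply T x" x] by (simp add: power2_eq_square mult.assoc)
    then show ?thesis
      using False by simp
  qed simp
  have inj: "x = x'" if "blinfun_apply T x = blinfun_apply T x'" for x x'
    using lower[of "x - x'"] that c by (simp add: blinfun.diff_right mult_le_0_iff)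
  have surj: "\<exists>x. blinfun_apply T x = y" for y
  proof -
    \<comment> \<open>Since \<open>s\<close> is nonzero, the fixed points of \<open>g\<close> are
      exactly the solutions of \<open>T x = y\<close>; differences of values of \<open>g\<close> do
      not involve \<open>y\<close>, so \<open>contr\<close> applies to them.\<close>
    define g where "g x = x - s *\<^sub>R (blinfun_apply T x - y)" for x
    have "dist (g x) (g x') \<le> q * dist x x'" for x x'
      using contr[of "x - x'"] by (simp add: g_def dist_norm blinfun.diff_right algebra_simps)
    then have "\<exists>!x. g x = x"
      using q by (intro banach_fix_type[of q]) auto
    then show ?thesis
      using s by (auto simp: g_def)
  qed
  define S where "S y = (SOME x. blinfun_apply T x = y)" for y
  have TS: "blinfun_apply T (S y) = y" for y
    unfolding S_def using surj[of y] by (rule someI_ex)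
  have ST: "S (blinfun_apply T x) = x" for x
    using TS inj by blast
  \<comment> \<open>\<open>S\<close> is only chosen pointwise. Each linearity law holds because
    \<open>T\<close> maps both of its sides to the same vector and is injective.\<close>
  have "bounded_linear S"
  proof (rule bounded_linear_intro)
    show "S (x + y) = S x + S y" for x y
      by (rule inj) (simp add: TS blinfun.add_right)
    show "S (r *\<^sub>R x) = r *\<^sub>R S x" for r x
      by (rule inj) (simp add: TS blinfun.scaleR_right)
    show "norm (S x) \<le> norm x * (1 / c)" for x
      using lower[of "S x"] c by (simp add: TS field_simps)
  qed
  then have apply_S: "blinfun_apply (Blinfun S) = S"
    by (rule bounded_linear_Blinfun_apply)
  have "S (a *\<^sub>C x) = a *\<^sub>C S x" for a x
    using T by - (rule inj, simp add: TS bounded_ops_def)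
  then have "is_inverse_op T (Blinfun S)"
    by (auto simp: is_inverse_op_def bounded_ops_def apply_S TS ST intro!: blinfun_eqI)
  then show ?thesis
    by (auto simp: invertible_op_def)
qed

text \<open>If \<open>A\<close> were bounded below by \<epsilon>, then
  \<open>norm_apply_sq_le_qform\<close> would make its form coercive with constant
  \<open>\<epsilon>\<^sup>2 / K\<close>, and \<open>A\<close> would be invertible.\<close>

lemma singular_positive_op_approx_null:
  fixes A :: "'h::chilbert_space \<Rightarrow>\<^sub>L 'h"
  assumes A: "positive_op A" and "0 \<in> Sp A" and e: "\<epsilon> > 0"
  obtains v where "v \<noteq> 0" "norm (blinfun_apply A v) \<le> \<epsilon> * norm v"
proof (rule ccontr)
  assume "\<not> thesis"
  then have low: "v \<noteq> 0 \<Longrightarrow> \<epsilon> * norm v < norm (blinfun_apply A v)" for v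
    using that by (meson not_le)
  define K where "K = norm A + 1"
  have K: "K > 0" "norm A \<le> K"
    by (auto simp: K_def add_nonneg_pos)
  have "invertible_op A"
  proof (rule coercive_imp_invertible)
    show "A \<in> bounded_ops"
      using A by (rule positive_op_bounded)
    show "\<epsilon>\<^sup>2 / K > 0"
      using e K by simp
    fix x
    have "(\<epsilon> * norm x)\<^sup>2 \<le> (norm (blinfun_apply A x))\<^sup>2"
      using low[of x] e by (intro power_mono) (cases "x = 0"; auto)+
    also have "\<dots> \<le> K * qform A x"
      by (rule norm_apply_sq_le_qform[OF A K])
    finally show "\<epsilon>\<^sup>2 / K * (norm x)\<^sup>2 \<le> qform A x"
      using K by (simp add: field_simps)
  qed
  with assms show False
    by (simp add: zero_in_Sp_iff)
qed

text \<open>A bounded inverse gives \<open>norm x \<le> L * norm (T x)\<close>, and positivity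
  bounds the square of \<open>norm (T x)\<close> by \<open>K * qform T x\<close>. The added 1 in
  \<open>K\<close> and \<open>L\<close> keeps these constants positive even for zero
  operators.\<close>

lemma invertible_positive_op_coercive:
  fixes T :: "'h::chilbert_space \<Rightarrow>\<^sub>L 'h"
  assumes T: "positive_op T" and "invertible_op T"
  obtains c where "c > 0" "\<And>x. c * (norm x)\<^sup>2 \<le> qform T x"
proof -
  obtain S where S: "S o\<^sub>L T = id_blinfun"
    using assms by (auto simp: invertible_op_def is_inverse_op_def)
  define K where "K = norm T + 1"
  define L where "L = norm S + 1"
  have K: "K > 0" "norm T \<le> K" and L: "L > 0" "norm S \<le> L"
    by (auto simp: K_def L_def add_nonneg_pos)
  have "1 / (L\<^sup>2 * K) * (norm x)\<^sup>2 \<le> qform T x" for x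
  proof -
    have "norm x = norm (blinfun_apply S (blinfun_apply T x))"
      using arg_cong[OF S, of "\<lambda>U. blinfun_apply U x"] by simp
    also have "\<dots> \<le> L * norm (blinfun_apply T x)"
      by (intro order_trans[OF norm_blinfun] mult_right_mono L) simp
    finally have "(norm x)\<^sup>2 \<le> (L * norm (blinfun_apply T x))\<^sup>2"
      by (intro power_mono) auto
    also have "\<dots> \<le> L\<^sup>2 * (K * qform T x)"
      unfolding power_mult_distrib by (intro mult_left_mono norm_apply_sq_le_qform[OF T K]) simp
    finally show ?thesis
      using K L by (simp add: field_simps)
  qed
  moreover have "1 / (L\<^sup>2 * K) > 0"
    using K L by simp
  ultimately show ?thesis
    using that by blast
qed

lemma is_inverse_op_scaleR_id:
  assumes "c \<noteq> 0"
  shows "is_inverse_op (c *\<^sub>R (id_blinfun :: 'h::chilbert_space \<Rightarrow>\<^sub>L 'h)) (inverse c *\<^sub>R id_blinfun)"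
  using assms
  by (auto simp: is_inverse_op_def bounded_ops_def blinfun.scaleR_left blinfun.scaleR_right
      scaleR_scaleC intro!: blinfun_eqI)

lemma inverse_op_eq:
  assumes "is_inverse_op T S"
  shows "inverse_op T = S"
  unfolding inverse_op_def
proof (rule the_equality)
  fix S' assume "is_inverse_op T S'"
  then show "S' = S"
    using assms unfolding is_inverse_op_def
    by (metis blinfun_apply_blinfun_compose blinfun_eqI id_apply id_blinfun.rep_eq)
qed (rule assms)

text \<open>On the zero space the zero operator is the identity and hence invertible; a nonzero
  vector tells the two apart.\<close>

lemma zero_in_Sp_zero:
  assumes "\<exists>v::'h::chilbert_space. v \<noteq> 0"
  shows "0 \<in> Sp (0 :: 'h \<Rightarrow>\<^sub>L 'h)"
proof -
  have "(0 :: 'h \<Rightarrow>\<^sub>L 'h) \<noteq> id_blinfun"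
    using assms by (metis blinfun.zero_left id_blinfun.rep_eq id_apply)
  then show ?thesis
    by (auto simp: zero_in_Sp_iff invertible_op_def is_inverse_op_def)
qed

section \<open>Connections\<close>

lemma connection_positive:
  "connection \<sigma> \<Longrightarrow> positive_op A \<Longrightarrow> positive_op B \<Longrightarrow> positive_op (\<sigma> A B)"
  by (simp add: connection_def)

lemma connection_mono:
  "connection \<sigma> \<Longrightarrow> positive_op A \<Longrightarrow> positive_op B \<Longrightarrow> positive_op C \<Longrightarrow> positive_op D \<Longrightarrow>
    A \<preceq> C \<Longrightarrow> B \<preceq> D \<Longrightarrow> \<sigma> A B \<preceq> \<sigma> C D"
  by (simp add: connection_def)

lemma connection_transformer:
  "connection \<sigma> \<Longrightarrow> positive_op A \<Longrightarrow> positive_op B \<Longrightarrow> positive_op C \<Longrightarrow>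
    C o\<^sub>L \<sigma> A B o\<^sub>L C \<preceq> \<sigma> (C o\<^sub>L A o\<^sub>L C) (C o\<^sub>L B o\<^sub>L C)"
  by (simp add: connection_def)

lemma connection_conjugate_bound:
  fixes \<sigma> :: "('h::chilbert_space \<Rightarrow>\<^sub>L 'h) \<Rightarrow> ('h \<Rightarrow>\<^sub>L 'h) \<Rightarrow> ('h \<Rightarrow>\<^sub>L 'h)"
  assumes \<sigma>: "connection \<sigma>" and f: "representing_function \<sigma> f"
    and X: "positive_op X" and A: "positive_op A" and C: "positive_op C"
    and a: "a > 0" and b: "b \<ge> 0"
    and CX: "\<And>x. qform X (blinfun_apply C x) \<le> a * (norm x)\<^sup>2"
    and CA: "\<And>x. qform A (blinfun_apply C x) \<le> b * (norm x)\<^sup>2"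
  shows "qform (\<sigma> X A) (blinfun_apply C x) \<le> a * f (b / a) * (norm x)\<^sup>2"
proof -
  \<comment> \<open>In \<open>D T D\<close> the scaling enters twice and divides the form by
    \<open>a\<close>. The first argument is thereby brought below the identity, which is where
    \<open>f\<close> describes the connection.\<close>
  define D where "D = (1 / sqrt a) *\<^sub>R C"
  have D: "positive_op D"
    unfolding D_def using C a by (intro positive_op_scaleR) auto
  have qD: "qform (D o\<^sub>L T o\<^sub>L D) y = qform T (blinfun_apply C y) / a" for T y
    unfolding cinner_conjugate[OF D] using a
    by (simp add: D_def blinfun.scaleR_left blinfun.scaleR_right cinner_simps flip: of_real_mult)
  have ba: "positive_op ((b / a) *\<^sub>R (id_blinfun :: 'h \<Rightarrow>\<^sub>L 'h))"
    using a b by (intro positive_op_scaleR positive_op_id) auto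
  have DX: "D o\<^sub>L X o\<^sub>L D \<preceq> id_blinfun"
    using a CX by (intro op_leI positive_op_conjugate positive_op_id D X)
      (simp add: qD cinner_self field_simps del: blinfun_apply_blinfun_compose)
  have DA: "D o\<^sub>L A o\<^sub>L D \<preceq> (b / a) *\<^sub>R id_blinfun"
    using a CA by (intro op_leI positive_op_conjugate ba D A)
      (simp add: qD cinner_simps blinfun.scaleR_left cinner_self field_simps
        del: blinfun_apply_blinfun_compose)
  have "qform (\<sigma> X A) (blinfun_apply C x) / a = qform (D o\<^sub>L \<sigma> X A o\<^sub>L D) x"
    by (simp only: qD)
  also have "\<dots> \<le> qform (\<sigma> (D o\<^sub>L X o\<^sub>L D) (D o\<^sub>L A o\<^sub>L D)) x"
    by (intro op_le_imp_qform_le connection_transformer[OF \<sigma>] X A D)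
  also have "\<dots> \<le> qform (\<sigma> id_blinfun ((b / a) *\<^sub>R id_blinfun)) x"
    by (intro op_le_imp_qform_le connection_mono[OF \<sigma>] positive_op_conjugate positive_op_id ba D X A DX DA)
  also have "\<sigma> id_blinfun ((b / a) *\<^sub>R id_blinfun) = f (b / a) *\<^sub>R id_blinfun"
    using f a b by (simp add: representing_function_def)
  also have "qform (f (b / a) *\<^sub>R id_blinfun) x = f (b / a) * (norm x)\<^sup>2"
    by (simp add: blinfun.scaleR_left cinner_simps cinner_self)
  finally show ?thesis
    using a by (simp add: field_simps)
qed

text \<open>The conjugation bound with \<open>C\<close> the identity, \<open>a = norm A + 1\<close>
  and \<open>b = 0\<close> leaves a form that is at most 0. A positive operator with such a form
  vanishes by \<open>norm_apply_sq_le_qform\<close>.\<close>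

lemma connection_zero_right:
  assumes \<sigma>: "connection \<sigma>" and f: "representing_function \<sigma> f" and f0: "f 0 = 0"
    and A: "positive_op A"
  shows "\<sigma> A 0 = 0"
proof (rule blinfun_eqI)
  fix x
  have pos: "positive_op (\<sigma> A 0)"
    by (intro connection_positive[OF \<sigma>] A positive_op_zero)
  have "qform (\<sigma> A 0) (blinfun_apply id_blinfun x) \<le> (norm A + 1) * f (0 / (norm A + 1)) * (norm x)\<^sup>2"
  proof (rule connection_conjugate_bound[OF \<sigma> f A positive_op_zero positive_op_id])
    show "norm A + 1 > 0"
      by (simp add: add_nonneg_pos)
    show "qform A (blinfun_apply id_blinfun y) \<le> (norm A + 1) * (norm y)\<^sup>2" for y
      using qform_le_norm[of A y] by (simp add: algebra_simps add_increasing)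
  qed (simp_all add: cinner_simps)
  then have "qform (\<sigma> A 0) x \<le> 0"
    by (simp add: f0)
  then have "(norm (\<sigma> A 0) + 1) * qform (\<sigma> A 0) x \<le> 0"
    by (intro mult_nonneg_nonpos) auto
  moreover have "(norm (blinfun_apply (\<sigma> A 0) x))\<^sup>2 \<le> (norm (\<sigma> A 0) + 1) * qform (\<sigma> A 0) x"
    by (rule norm_apply_sq_le_qform[OF pos]) (simp_all add: add_nonneg_pos)
  ultimately have "(norm (blinfun_apply (\<sigma> A 0) x))\<^sup>2 \<le> 0"
    by linarith
  then show "blinfun_apply (\<sigma> A 0) x = blinfun_apply 0 x"
    by simp
qed

text \<open>\<open>C\<close> is the inverse of \<open>R = I + A / \<epsilon>\<close>, that is,
  \<epsilon> times the inverse of \<open>A + \<epsilon> I\<close>. Positivity of \<open>A\<close>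
  makes \<open>R\<close> coercive with constant 1, so the inverse exists.\<close>

lemma resolvent_conjugation:
  fixes A :: "'h::chilbert_space \<Rightarrow>\<^sub>L 'h"
  assumes A: "positive_op A" and e: "\<epsilon> > 0"
  obtains C where "positive_op C"
    and "\<And>x. norm (blinfun_apply C x) \<le> norm x"
    and "\<And>x. qform A (blinfun_apply C x) \<le> \<epsilon> * (norm x)\<^sup>2"
    and "\<And>u. blinfun_apply C (u + (1 / \<epsilon>) *\<^sub>R blinfun_apply A u) = u"
proof -
  define R where "R = id_blinfun + (1 / \<epsilon>) *\<^sub>R A"
  have R_apply: "blinfun_apply R u = u + (1 / \<epsilon>) *\<^sub>R blinfun_apply A u" for u
    by (simp add: R_def blinfun.add_left blinfun.scaleR_left)
  have A_lin: "blinfun_apply A (c *\<^sub>C x) = c *\<^sub>C blinfun_apply A x" for c x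
    using A by (simp add: positive_op_def bounded_ops_def)
  have A_real: "Im (cinner (blinfun_apply A u) u) = 0" for u
    using A by (simp add: positive_op_def complex_is_Real_iff)
  have "R \<in> bounded_ops"
    by (auto simp: bounded_ops_def R_apply A_lin scaleC_add_right scaleR_scaleC)
  moreover have "1 * (norm x)\<^sup>2 \<le> qform R x" for x
    using positive_op_nonneg[OF A, of x] e by (simp add: R_apply cinner_simps cinner_self)
  ultimately have "invertible_op R"
    by (intro coercive_imp_invertible[of R 1]) auto
  then obtain C where C: "C \<in> bounded_ops" "R o\<^sub>L C = id_blinfun" "C o\<^sub>L R = id_blinfun"
    by (auto simp: invertible_op_def is_inverse_op_def)
  have RC: "blinfun_apply R (blinfun_apply C x) = x" for x
    using arg_cong[OF C(2), of "\<lambda>U. blinfun_apply U x"] by simp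
  have CR: "blinfun_apply C (blinfun_apply R x) = x" for x
    using arg_cong[OF C(3), of "\<lambda>U. blinfun_apply U x"] by simp
  \<comment> \<open>Taken at \<open>u = C x\<close>, where \<open>R u = x\<close>, this identity has
    nonnegative summands adding up to the squared norm of \<open>x\<close>. Keeping the first one
    gives the contraction property, keeping the second one the bound on the form of
    \<open>A\<close>.\<close>
  have nR: "(norm (blinfun_apply R u))\<^sup>2
      = (norm u)\<^sup>2 + 2 / \<epsilon> * qform A u + (norm (blinfun_apply A u))\<^sup>2 / \<epsilon>\<^sup>2" for u
  proof -
    have "(norm (blinfun_apply R u))\<^sup>2 = Re (cinner (blinfun_apply R u) (blinfun_apply R u))"
      by (subst cinner_self) simp
    also have "\<dots> = (norm u)\<^sup>2 + 2 / \<epsilon> * qform A u + (norm (blinfun_apply A u))\<^sup>2 / \<epsilon>\<^sup>2"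
      using e positive_op_selfadjoint[OF A, of u u]
      by (simp only: R_apply cinner_simps) (simp add: cinner_self field_simps power2_eq_square)
    finally show ?thesis .
  qed
  have "positive_op C"
    unfolding positive_op_def
  proof (intro conjI allI C)
    fix x
    define u where "u = blinfun_apply C x"
    \<comment> \<open>Substituting \<open>x = R u\<close> turns the form of \<open>C\<close> at
      \<open>x\<close> into that of \<open>R\<close> at \<open>u\<close>, whose reality and sign are
      inherited from \<open>A\<close>.\<close>
    have "x = u + (1 / \<epsilon>) *\<^sub>R blinfun_apply A u"
      using RC[of x] by (simp add: u_def R_apply)
    then have eq: "cinner (blinfun_apply C x) x
        = of_real ((norm u)\<^sup>2) + of_real (1 / \<epsilon>) * cinner (blinfun_apply A u) u"
      using positive_op_selfadjoint[OF A, of u u]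
      by (metis u_def cinner_add_right cinner_scaleR_right cinner_self)
    show "cinner (blinfun_apply C x) x \<in> \<real>"
      unfolding eq by (simp add: complex_is_Real_iff A_real)
    show "0 \<le> qform C x"
      unfolding eq using positive_op_nonneg[OF A, of u] e by simp
  qed
  moreover have "norm (blinfun_apply C x) \<le> norm x" for x
  proof (rule power2_le_imp_le)
    have "0 \<le> 2 / \<epsilon> * qform A (blinfun_apply C x)"
      using positive_op_nonneg[OF A] e by simp
    then show "(norm (blinfun_apply C x))\<^sup>2 \<le> (norm x)\<^sup>2"
      using nR[of "blinfun_apply C x"] by (simp add: RC)
  qed simp
  moreover have "qform A (blinfun_apply C x) \<le> \<epsilon> * (norm x)\<^sup>2" for x
  proof -
    have "2 / \<epsilon> * qform A (blinfun_apply C x) \<le> (norm x)\<^sup>2"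
      using nR[of "blinfun_apply C x"] by (simp add: RC)
    then have "2 * qform A (blinfun_apply C x) \<le> \<epsilon> * (norm x)\<^sup>2"
      using e by (simp add: field_simps)
    then show ?thesis
      using positive_op_nonneg[OF A, of "blinfun_apply C x"] by linarith
  qed
  moreover have "blinfun_apply C (u + (1 / \<epsilon>) *\<^sub>R blinfun_apply A u) = u" for u
    using CR[of u] by (simp add: R_apply)
  ultimately show ?thesis
    using that by blast
qed

lemma connection_singular_right:
  fixes \<sigma> :: "('h::chilbert_space \<Rightarrow>\<^sub>L 'h) \<Rightarrow> ('h \<Rightarrow>\<^sub>L 'h) \<Rightarrow> ('h \<Rightarrow>\<^sub>L 'h)"
  assumes \<sigma>: "connection \<sigma>" and f: "representing_function \<sigma> f" and f0: "f 0 = 0"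
    and A: "positive_op A" and X: "positive_op X" and "0 \<in> Sp A"
  shows "0 \<in> Sp (\<sigma> X A)"
proof (rule ccontr)
  assume "0 \<notin> Sp (\<sigma> X A)"
  then have "invertible_op (\<sigma> X A)"
    by (simp add: zero_in_Sp_iff)
  then obtain c where c: "c > 0" "\<And>x. c * (norm x)\<^sup>2 \<le> qform (\<sigma> X A) x"
    using invertible_positive_op_coercive[OF connection_positive[OF \<sigma> X A]] by blast
  define a where "a = norm X + 1"
  have a: "a > 0" "norm X \<le> a"
    by (auto simp: a_def add_nonneg_pos)
  have "continuous_on {0..} f"
    using f by (simp add: representing_function_def operator_monotone_on_def)
  \<comment> \<open>The tolerance anticipates the final chain: \<open>a\<close> is the factor in the
    conjugation bound and 4 is the square of the 2 in
    \<open>norm w \<le> 2 * norm v\<close>.\<close>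
  then obtain d where d: "d > 0" "\<And>y. y \<ge> 0 \<Longrightarrow> dist y 0 < d \<Longrightarrow> dist (f y) (f 0) < c / (4 * a)"
    using c a unfolding continuous_on_iff by (metis atLeast_iff order_refl divide_pos_pos mult_pos_pos zero_less_numeral)
  \<comment> \<open>Then \<open>\<epsilon> / a = d / 2\<close>, safely inside the continuity
    radius.\<close>
  define \<epsilon> where "\<epsilon> = a * d / 2"
  have e: "\<epsilon> > 0"
    using a d by (simp add: \<epsilon>_def)
  have "f (\<epsilon> / a) < c / (4 * a)"
    using d(2)[of "\<epsilon> / a"] a d(1) f0 by (simp add: \<epsilon>_def dist_real_def)
  then have small: "4 * (a * f (\<epsilon> / a)) < c"
    using a by (simp add: field_simps)
  have f_nonneg: "0 \<le> a * f (\<epsilon> / a)"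
    using f e a by (simp add: representing_function_def operator_monotone_on_def)
  obtain C where C: "positive_op C" "\<And>x. norm (blinfun_apply C x) \<le> norm x"
      "\<And>x. qform A (blinfun_apply C x) \<le> \<epsilon> * (norm x)\<^sup>2"
      "\<And>u. blinfun_apply C (u + (1 / \<epsilon>) *\<^sub>R blinfun_apply A u) = u"
    using resolvent_conjugation[OF A e] by blast
  obtain v where v: "v \<noteq> 0" "norm (blinfun_apply A v) \<le> \<epsilon> * norm v"
    using singular_positive_op_approx_null[OF A \<open>0 \<in> Sp A\<close> e] by blast
  \<comment> \<open>\<open>w\<close> is the preimage of \<open>v\<close> under \<open>C\<close>.
    Taking the same \<epsilon> for \<open>C\<close> and for the approximate null vector keeps
    \<open>norm w\<close> within twice \<open>norm v\<close>.\<close>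
  define w where "w = v + (1 / \<epsilon>) *\<^sub>R blinfun_apply A v"
  have CX: "qform X (blinfun_apply C x) \<le> a * (norm x)\<^sup>2" for x
  proof -
    have "qform X (blinfun_apply C x) \<le> norm X * (norm (blinfun_apply C x))\<^sup>2"
      by (rule qform_le_norm)
    also have "\<dots> \<le> a * (norm x)\<^sup>2"
      using a C(2) by (intro mult_mono power_mono) auto
    finally show ?thesis .
  qed
  have "norm w \<le> norm v + norm ((1 / \<epsilon>) *\<^sub>R blinfun_apply A v)"
    unfolding w_def by (rule norm_triangle_ineq)
  also have "\<dots> \<le> 2 * norm v"
    using v e by (simp add: field_simps)
  finally have w: "(norm w)\<^sup>2 \<le> 4 * (norm v)\<^sup>2"
    using power_mono[of "norm w" "2 * norm v" 2] by (simp add: power_mult_distrib)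
  have "c * (norm v)\<^sup>2 \<le> qform (\<sigma> X A) v"
    by (rule c)
  also have "v = blinfun_apply C w"
    by (simp add: w_def C(4))
  also have "qform (\<sigma> X A) (blinfun_apply C w) \<le> a * f (\<epsilon> / a) * (norm w)\<^sup>2"
    using e by (intro connection_conjugate_bound[OF \<sigma> f X A C(1) a(1)] CX C(3)) auto
  also have "\<dots> \<le> a * f (\<epsilon> / a) * (4 * (norm v)\<^sup>2)"
    using w f_nonneg by (intro mult_left_mono)
  also have "\<dots> = (4 * (a * f (\<epsilon> / a))) * (norm v)\<^sup>2"
    by simp
  also have "\<dots> < c * (norm v)\<^sup>2"
    using small v by (intro mult_strict_right_mono) auto
  finally show False
    using C(4)[of v] by (simp add: w_def)
qed

section \<open>The atom of the associated measure at zero\<close>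

text \<open>Scalar operators are inverted as numbers. Clearing the inner inverses gives a quotient
  whose limit as \<open>b\<close> tends to 0 can be read off.\<close>

lemma harmonic_mean_pos_scalar:
  assumes "0 \<le> t" "t \<le> 1" "a > 0" "b > 0"
  shows "harmonic_mean_pos t (a *\<^sub>R id_blinfun) (b *\<^sub>R id_blinfun)
    = (a * b / ((1 - t) * b + t * a)) *\<^sub>R (id_blinfun :: 'h::chilbert_space \<Rightarrow>\<^sub>L 'h)"
proof -
  have inv: "inverse_op (c *\<^sub>R (id_blinfun :: 'h \<Rightarrow>\<^sub>L 'h)) = inverse c *\<^sub>R id_blinfun" if "c \<noteq> 0" for c
    by (intro inverse_op_eq is_inverse_op_scaleR_id that)
  have "(1 - t) * b + t * a > 0"
    using assms by (cases "t = 0") (auto intro: add_nonneg_pos)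
  moreover have "(1 - t) * inverse a + t * inverse b = ((1 - t) * b + t * a) / (a * b)"
    using assms by (simp add: field_simps)
  ultimately show ?thesis
    using assms by (simp add: harmonic_mean_pos_def inv flip: scaleR_left_distrib)
qed

text \<open>On a nonzero space 0 is not strictly positive, so the regularised limit defines the
  mean. The regularised means are scalar, and their coefficients tend to 1 for \<open>t = 0\<close>
  and to 0 for \<open>t > 0\<close>.\<close>

lemma harmonic_mean_id_zero:
  assumes nz: "\<exists>v::'h::chilbert_space. v \<noteq> 0" and t: "0 \<le> t" "t \<le> 1"
  shows "harmonic_mean t id_blinfun 0 = indicator {0} t *\<^sub>R (id_blinfun :: 'h \<Rightarrow>\<^sub>L 'h)"
proof -
  let ?I = "id_blinfun :: 'h \<Rightarrow>\<^sub>L 'h"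
  let ?h = "\<lambda>\<epsilon>. harmonic_mean_pos t (?I + \<epsilon> *\<^sub>R ?I) (0 + \<epsilon> *\<^sub>R ?I)"
  have h: "?h \<epsilon> = ((1 + \<epsilon>) * \<epsilon> / ((1 - t) * \<epsilon> + t * (1 + \<epsilon>))) *\<^sub>R ?I" if "\<epsilon> > 0" for \<epsilon>
    using harmonic_mean_pos_scalar[OF t, of "1 + \<epsilon>" \<epsilon>] that
    by (simp add: scaleR_left_distrib)
  have scal: "((\<lambda>\<epsilon>. (1 + \<epsilon>) * \<epsilon> / ((1 - t) * \<epsilon> + t * (1 + \<epsilon>))) \<longlongrightarrow> indicator {0} t) (at_right 0)"
  proof (cases "t = 0")
    case True
    \<comment> \<open>For \<open>t = 0\<close> the denominator tends to 0, so the quotient rule for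
      limits is replaced by cancelling \<epsilon>, which is valid off 0.\<close>
    have "((\<lambda>\<epsilon>. 1 + \<epsilon>) \<longlongrightarrow> 1 + 0) (at_right (0::real))"
      by (intro tendsto_intros)
    then have "((\<lambda>\<epsilon>. (1 + \<epsilon>) * \<epsilon> / ((1 - t) * \<epsilon> + t * (1 + \<epsilon>))) \<longlongrightarrow> 1 + 0) (at_right (0::real))"
      by (rule Lim_transform_eventually) (use True in \<open>auto simp: eventually_at_filter\<close>)
    then show ?thesis
      using True by simp
  next
    case False
    have "((\<lambda>\<epsilon>. (1 + \<epsilon>) * \<epsilon> / ((1 - t) * \<epsilon> + t * (1 + \<epsilon>)))
        \<longlongrightarrow> (1 + 0) * 0 / ((1 - t) * 0 + t * (1 + 0))) (at_right (0::real))"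
      using False by (intro tendsto_intros) auto
    then show ?thesis
      using False by simp
  qed
  have lim: "((\<lambda>\<epsilon>. blinfun_apply (?h \<epsilon>) x)
      \<longlongrightarrow> blinfun_apply (indicator {0} t *\<^sub>R ?I) x) (at_right 0)" for x
  proof -
    have "((\<lambda>\<epsilon>. ((1 + \<epsilon>) * \<epsilon> / ((1 - t) * \<epsilon> + t * (1 + \<epsilon>))) *\<^sub>R x)
        \<longlongrightarrow> indicator {0} t *\<^sub>R x) (at_right 0)"
      by (intro tendsto_scaleR scal tendsto_const)
    then show ?thesis
      unfolding blinfun.scaleR_left id_blinfun.rep_eq id_apply
      by (rule Lim_transform_eventually, intro eventually_mono[OF eventually_at_right_less])
        (simp only: h blinfun.scaleR_left id_blinfun.rep_eq id_apply)
  qed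
  have "\<not> strictly_positive_op (0 :: 'h \<Rightarrow>\<^sub>L 'h)"
    using zero_in_Sp_zero[OF nz] by (simp add: strictly_positive_op_def zero_in_Sp_iff)
  then have "harmonic_mean t ?I 0 = (THE S. \<forall>x. ((\<lambda>\<epsilon>. blinfun_apply (?h \<epsilon>) x)
      \<longlongrightarrow> blinfun_apply S x) (at_right 0))"
    by (simp add: harmonic_mean_def)
  also have "\<dots> = indicator {0} t *\<^sub>R ?I"
  proof (rule the_equality)
    fix S :: "'h \<Rightarrow>\<^sub>L 'h"
    assume S: "\<forall>x. ((\<lambda>\<epsilon>. blinfun_apply (?h \<epsilon>) x) \<longlongrightarrow> blinfun_apply S x) (at_right 0)"
    show "S = indicator {0} t *\<^sub>R ?I"
      by (rule blinfun_eqI) (rule tendsto_unique[OF trivial_limit_at_right_real S[rule_format] lim])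
  qed (use lim in blast)
  finally show ?thesis .
qed

text \<open>Testing the weak integral at one nonzero vector \<open>v\<close> suffices: the integrand
  is the indicator of {0} times \<open>cinner v v\<close>, and this nonzero factor cancels.\<close>

lemma representing_function_zero_eq_atom:
  fixes \<sigma> :: "('h::chilbert_space \<Rightarrow>\<^sub>L 'h) \<Rightarrow> ('h \<Rightarrow>\<^sub>L 'h) \<Rightarrow> ('h \<Rightarrow>\<^sub>L 'h)"
  assumes nz: "\<exists>v::'h. v \<noteq> 0" and \<sigma>: "\<sigma> id_blinfun 0 = f 0 *\<^sub>R id_blinfun"
    and \<mu>: "associated_measure \<sigma> \<mu>"
  shows "f 0 = measure \<mu> {0}"
proof -
  obtain v :: 'h where v: "v \<noteq> 0"
    using nz by blast
  interpret finite_measure \<mu>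
    using \<mu> by (simp add: associated_measure_def)
  have sets: "sets \<mu> = sets (restrict_space borel {0..1})"
    using \<mu> by (simp add: associated_measure_def)
  have space: "space \<mu> = {0..1}"
    using sets_eq_imp_space_eq[OF sets] by (simp add: space_restrict_space)
  have atom: "{0} \<in> sets \<mu>"
    unfolding sets by (auto simp: sets_restrict_space_iff)
  have "has_bochner_integral \<mu> (\<lambda>t. cinner (blinfun_apply (harmonic_mean t id_blinfun 0) v) v)
      (cinner (blinfun_apply (\<sigma> id_blinfun 0) v) v)"
    using \<mu> positive_op_id positive_op_zero
    unfolding associated_measure_def has_op_integral_def by blast
  \<comment> \<open>The formula for the mean requires \<open>t\<close> in [0,1], which is exactly
    the space of \<mu>.\<close>
  moreover have "cinner (blinfun_apply (harmonic_mean t id_blinfun 0) v) v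
      = indicator {0} t *\<^sub>R cinner v v" if "t \<in> space \<mu>" for t
    using that harmonic_mean_id_zero[OF nz, of t]
    by (simp add: space blinfun.scaleR_left cinner_simps scaleR_conv_of_real)
  ultimately have "has_bochner_integral \<mu> (\<lambda>t. indicator {0} t *\<^sub>R cinner v v)
      (f 0 *\<^sub>R cinner v v)"
    by (simp add: \<sigma> blinfun.scaleR_left cinner_simps scaleR_conv_of_real
        cong: has_bochner_integral_cong)
  moreover have "has_bochner_integral \<mu> (\<lambda>t. indicator {0} t *\<^sub>R cinner v v)
      (measure \<mu> {0} *\<^sub>R cinner v v)"
    using atom by (intro has_bochner_integral_indicator) (simp_all add: emeasure_finite less_top[symmetric])
  ultimately have "f 0 *\<^sub>R cinner v v = measure \<mu> {0} *\<^sub>R cinner v v"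
    by (rule has_bochner_integral_eq)
  then show ?thesis
    using v by (simp add: cinner_self)
qed

theorem theorem4p1:
  fixes \<sigma> :: "('h::chilbert_space \<Rightarrow>\<^sub>L 'h) \<Rightarrow> ('h \<Rightarrow>\<^sub>L 'h) \<Rightarrow> ('h \<Rightarrow>\<^sub>L 'h)"
    and f :: "real \<Rightarrow> real"
    and \<mu> :: "real measure"
  assumes "\<exists>v::'h. v \<noteq> 0"
    and "connection \<sigma>"
    and "representing_function \<sigma> f"
    and "associated_measure \<sigma> \<mu>"
  shows "(f 0 = 0 \<longleftrightarrow> emeasure \<mu> {0} = 0) \<and>
         (f 0 = 0 \<longleftrightarrow> \<sigma> id_blinfun 0 = 0) \<and>
         (f 0 = 0 \<longleftrightarrow> (\<forall>A. positive_op A \<longrightarrow> \<sigma> A 0 = 0)) \<and>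
         (f 0 = 0 \<longleftrightarrow> (\<forall>A. positive_op A \<longrightarrow> 0 \<in> Sp A \<longrightarrow> 0 \<in> Sp (\<sigma> id_blinfun A))) \<and>
         (f 0 = 0 \<longleftrightarrow> (\<forall>A X. positive_op A \<longrightarrow> positive_op X \<longrightarrow> 0 \<in> Sp A \<longrightarrow> 0 \<in> Sp (\<sigma> X A)))"
proof -
  have \<sigma>0: "\<sigma> id_blinfun 0 = f 0 *\<^sub>R id_blinfun"
    using assms(3) unfolding representing_function_def by (metis order_refl scaleR_zero_left)
  interpret finite_measure \<mu>
    using assms(4) by (simp add: associated_measure_def)
  have id_nz: "id_blinfun \<noteq> (0 :: 'h \<Rightarrow>\<^sub>L 'h)"
    using assms(1) by (metis blinfun.zero_left id_blinfun.rep_eq id_apply)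
  have e2: "f 0 = 0 \<longleftrightarrow> emeasure \<mu> {0} = 0"
    using representing_function_zero_eq_atom[where f = f, OF assms(1) \<sigma>0 assms(4)]
    by (simp add: emeasure_eq_measure)
  have e3: "f 0 = 0 \<longleftrightarrow> \<sigma> id_blinfun 0 = 0"
    using id_nz by (simp add: \<sigma>0)
  have e4: "f 0 = 0 \<longleftrightarrow> (\<forall>A. positive_op A \<longrightarrow> \<sigma> A 0 = 0)"
    using connection_zero_right[OF assms(2,3)] positive_op_id e3 by blast
  have i6: "0 \<in> Sp (\<sigma> X A)" if "f 0 = 0" "positive_op A" "positive_op X" "0 \<in> Sp A" for A X
    using connection_singular_right[OF assms(2,3)] that by blast
  \<comment> \<open>The test operator is \<open>A = 0\<close>: it is singular, whereas
    \<open>f 0\<close> times the identity would be invertible for nonzero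
    \<open>f 0\<close>.\<close>
  have i1: "f 0 = 0" if "\<forall>A. positive_op A \<longrightarrow> 0 \<in> Sp A \<longrightarrow> 0 \<in> Sp (\<sigma> id_blinfun A)"
  proof (rule ccontr)
    assume "f 0 \<noteq> 0"
    then have "invertible_op (\<sigma> id_blinfun 0)"
      unfolding \<sigma>0 invertible_op_def using is_inverse_op_scaleR_id by blast
    moreover have "0 \<in> Sp (\<sigma> id_blinfun 0)"
      using that positive_op_zero zero_in_Sp_zero[OF assms(1)] by blast
    ultimately show False
      by (simp add: zero_in_Sp_iff)
  qed
  have e5: "f 0 = 0 \<longleftrightarrow> (\<forall>A. positive_op A \<longrightarrow> 0 \<in> Sp A \<longrightarrow> 0 \<in> Sp (\<sigma> id_blinfun A))"
    using i1 i6[OF _ _ positive_op_id] by auto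
  \<comment> \<open>The backward direction takes \<open>X\<close> to be the identity and falls back
    on \<open>i1\<close>.\<close>
  have e6: "f 0 = 0 \<longleftrightarrow>
      (\<forall>A X. positive_op A \<longrightarrow> positive_op X \<longrightarrow> 0 \<in> Sp A \<longrightarrow> 0 \<in> Sp (\<sigma> X A))"
    using i1 i6 positive_op_id by auto
  show ?thesis
    using e2 e3 e4 e5 e6 by (intro conjI)
qed

end
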